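(* Let $\mathbf A$ be a Łukasiewicz near semiring and $a\in A$. Then the least ideal $I(a)$ of $\mathbf A$ containing $a$ is $I(a)=\{p(a): p\in \mathrm{Pol}_1(\mathbf A),\ p(0)=0\}$.
   Context: An $\iota$-near semiring is an algebra $\langle A,+,\cdot,{}^{\alpha},0,1\rangle$ of type $\langle 2,2,1,0,0\rangle$ such that $\langle A,+\rangle$ is a join semilattice with least element $0$ and greatest element $1$ (order $x\le y$ iff $x+y=y$), $x\cdot1=x=1\cdot x$, $(x+y)\cdot z=xz+yz$, $x0=0x=0$, $(x^{\alpha})^{\alpha}=x$, and $x\le y$ implies $y^{\alpha}\le x^{\alpha}$. A Łukasiewicz near semiring is an $\iota$-near semiring satisfying $(x y^{\alpha})^{\alpha} y^{\alpha}=(y x^{\alpha})^{\alpha} x^{\alpha}$. Juxtaposition $xy$ denotes $x\cdot y$. An ideal of $\mathbf A$ is a set $I\subseteq A$ with $0\in I$ such that (I1) if $ab^{\alpha}\in I$ and $b\in I$ then $a\in I$; (I2) if $a^{\alpha}b\in I$ and $b^{\alpha}a\in I$ then $(ac)^{\alpha}(bc)\in I$ and $(ca)^{\alpha}(cb)\in I$ for every $c\in A$. $\mathrm{Pol}_1(\mathbf A)$ is the set of unary polynomials of $\mathbf A$, i.e. functions $x\mapsto t^{\mathbf A}(x,e_1,\dots,e_n)$ with $t$ an $(n+1)$-ary term in the signature $(+,\cdot,{}^{\alpha},0,1)$ and $e_1,\dots,e_n\in A$. *)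

theory Defs
  imports Main
begin

text \<open>
  A join semilattice with least element \<open>0\<close> and greatest element \<open>1\<close>, written additively:
  neutrality of \<open>0\<close>, inherited from \<^class>\<open>comm_monoid_add\<close>, says that \<open>0\<close> is least.
  The one-element algebra (\<open>0 = 1\<close>) is allowed.
\<close>
class bounded_join_semilattice_add = comm_monoid_add + one +
  assumes add_idem: "x + x = x"
    and add_one: "x + 1 = 1"
begin

definition join_le :: "'a \<Rightarrow> 'a \<Rightarrow> bool"  (infix "\<sqsubseteq>" 50)
  where "x \<sqsubseteq> y \<longleftrightarrow> x + y = y"

end

text \<open>
  Multiplication is neither associative nor commutative, and it distributes over \<open>+\<close> from the
  right only; \<open>x * 0 = 0 = 0 * x\<close> is inherited from \<^class>\<open>mult_zero\<close>.
\<close>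
class iota_near_semiring = bounded_join_semilattice_add + mult_zero +
  fixes alpha :: "'a \<Rightarrow> 'a"  ("_\<^sup>\<alpha>" [1000] 999)
  assumes mult_one_right: "x * 1 = x"
    and mult_one_left: "1 * x = x"
    and add_mult_distrib_right: "(x + y) * z = x * z + y * z"
    and alpha_involutive: "(x\<^sup>\<alpha>)\<^sup>\<alpha> = x"
    and alpha_antitone: "x \<sqsubseteq> y \<Longrightarrow> y\<^sup>\<alpha> \<sqsubseteq> x\<^sup>\<alpha>"

class lukasiewicz_near_semiring = iota_near_semiring +
  assumes lukasiewicz: "(x * y\<^sup>\<alpha>)\<^sup>\<alpha> * y\<^sup>\<alpha> = (y * x\<^sup>\<alpha>)\<^sup>\<alpha> * x\<^sup>\<alpha>"

definition is_ideal :: "'a::lukasiewicz_near_semiring set \<Rightarrow> bool" where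
  "is_ideal I \<longleftrightarrow>
     0 \<in> I \<and>
     (\<forall>a b. a * b\<^sup>\<alpha> \<in> I \<and> b \<in> I \<longrightarrow> a \<in> I) \<and>
     (\<forall>a b. a\<^sup>\<alpha> * b \<in> I \<and> b\<^sup>\<alpha> * a \<in> I \<longrightarrow>
        (\<forall>c. (a * c)\<^sup>\<alpha> * (b * c) \<in> I \<and> (c * a)\<^sup>\<alpha> * (c * b) \<in> I))"

definition is_least_ideal_containing ::
    "'a::lukasiewicz_near_semiring \<Rightarrow> 'a set \<Rightarrow> bool" where
  "is_least_ideal_containing a I \<longleftrightarrow>
     is_ideal I \<and> a \<in> I \<and> (\<forall>J. is_ideal J \<and> a \<in> J \<longrightarrow> I \<subseteq> J)"

datatype nsr_term =
    Var nat
  | Zero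
  | One
  | Add nsr_term nsr_term
  | Mult nsr_term nsr_term
  | Alpha nsr_term

primrec vars :: "nsr_term \<Rightarrow> nat set" where
  "vars (Var i) = {i}"
| "vars Zero = {}"
| "vars One = {}"
| "vars (Add s t) = vars s \<union> vars t"
| "vars (Mult s t) = vars s \<union> vars t"
| "vars (Alpha t) = vars t"

primrec eval_term :: "(nat \<Rightarrow> 'a::lukasiewicz_near_semiring) \<Rightarrow> nsr_term \<Rightarrow> 'a" where
  "eval_term \<sigma> (Var i) = \<sigma> i"
| "eval_term \<sigma> Zero = 0"
| "eval_term \<sigma> One = 1"
| "eval_term \<sigma> (Add s t) = eval_term \<sigma> s + eval_term \<sigma> t"
| "eval_term \<sigma> (Mult s t) = eval_term \<sigma> s * eval_term \<sigma> t"
| "eval_term \<sigma> (Alpha t) = (eval_term \<sigma> t)\<^sup>\<alpha>"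

text \<open>
  With \<open>es = [e\<^sub>1, \<dots>, e\<^sub>n]\<close>, an \<open>(n+1)\<close>-ary term has its variables among \<open>0, \<dots>, n\<close>; variable \<open>0\<close>
  takes the argument \<open>x\<close> and variable \<open>i\<close> the parameter \<open>e\<^sub>i\<close>.
\<close>
definition Pol1 :: "('a::lukasiewicz_near_semiring \<Rightarrow> 'a) set" where
  "Pol1 = {(\<lambda>x. eval_term (\<lambda>i. (x # es) ! i) t) | t es. vars t \<subseteq> {..length es}}"

end

theory Submission
  imports Defs
begin

text \<open>
  In a Lukasiewicz near semiring \<open>(x\<^sup>\<alpha> * y)\<^sup>\<alpha> * y\<close> is the meet of \<open>x\<close> and \<open>y\<close>, so meets and joins
  are terms in \<open>*\<close> and \<open>\<alpha>\<close>. Hence every ideal \<open>J\<close> is the \<open>0\<close>-class of the congruence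
  \<open>x\<^sup>\<alpha> * y \<in> J \<and> y\<^sup>\<alpha> * x \<in> J\<close>, and so contains \<open>p a\<close> whenever \<open>a \<in> J\<close> and \<open>p 0 = 0\<close>.
  Conversely, the values \<open>p a\<close> form an ideal because both ideal conditions are witnessed by terms.
  With \<open>u = x * y\<^sup>\<alpha>\<close> and \<open>v = y\<close>, the element \<open>x\<close> is the meet of \<open>x\<close> with \<open>(u\<^sup>\<alpha> * v\<^sup>\<alpha>)\<^sup>\<alpha>\<close>, and this
  vanishes at \<open>u = v = 0\<close>. With \<open>u = x\<^sup>\<alpha> * y\<close> and \<open>v = y\<^sup>\<alpha> * x\<close> we have \<open>x = u\<^sup>\<alpha> * y + x\<close> and
  \<open>y = v\<^sup>\<alpha> * x + y\<close>, and these two terms agree (both are \<open>x + y\<close>) at \<open>u = v = 0\<close>.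
\<close>

subsection \<open>Order, meets and joins\<close>

context bounded_join_semilattice_add
begin

lemma join_le_antisym: "x \<sqsubseteq> y \<Longrightarrow> y \<sqsubseteq> x \<Longrightarrow> x = y"
  by (metis join_le_def add.commute)

lemma join_le_one: "x \<sqsubseteq> 1"
  by (simp add: join_le_def add_one)

lemma zero_join_le: "0 \<sqsubseteq> x"
  by (simp add: join_le_def)

lemma join_le_zero_iff: "x \<sqsubseteq> 0 \<longleftrightarrow> x = 0"
  by (simp add: join_le_def)

lemma join_le_add1: "x \<sqsubseteq> x + y"
  by (metis join_le_def add.assoc add_idem)

lemma join_le_add2: "y \<sqsubseteq> x + y"
  by (metis join_le_add1 add.commute)

lemma add_join_le: "x \<sqsubseteq> z \<Longrightarrow> y \<sqsubseteq> z \<Longrightarrow> x + y \<sqsubseteq> z"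
  by (metis join_le_def add.assoc)

end

context iota_near_semiring
begin

lemma mult_right_mono_join: "x \<sqsubseteq> y \<Longrightarrow> x * z \<sqsubseteq> y * z"
  by (metis join_le_def add_mult_distrib_right)

lemma mult_join_le_right: "x * y \<sqsubseteq> y"
  using mult_right_mono_join[OF join_le_one, of x y] by (simp add: mult_one_left)

lemma alpha_join_le_swap: "x \<sqsubseteq> y\<^sup>\<alpha> \<Longrightarrow> y \<sqsubseteq> x\<^sup>\<alpha>"
  by (metis alpha_antitone alpha_involutive)

lemma alpha_zero: "0\<^sup>\<alpha> = 1"
  by (rule join_le_antisym[OF join_le_one]) (rule alpha_join_le_swap[OF zero_join_le])

lemma alpha_one: "1\<^sup>\<alpha> = 0"
  by (metis alpha_zero alpha_involutive)

end

context lukasiewicz_near_semiring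
begin

text \<open>At \<open>1\<close> and \<open>x\<close>, the right side of the Lukasiewicz identity
  ends in the factor \<open>1\<^sup>\<alpha> = 0\<close>, while the left side reduces to
  \<open>x * x\<^sup>\<alpha>\<close>.\<close>

lemma mult_alpha_self: "x * x\<^sup>\<alpha> = 0"
  using lukasiewicz[of 1 x] by (simp add: alpha_one alpha_involutive mult_one_left)

lemma alpha_mult_self: "x\<^sup>\<alpha> * x = 0"
  by (metis mult_alpha_self alpha_involutive)

lemma mult_eq_zeroI: "x \<sqsubseteq> y\<^sup>\<alpha> \<Longrightarrow> x * y = 0"
  using mult_right_mono_join[of x "y\<^sup>\<alpha>" y] by (simp add: alpha_mult_self join_le_zero_iff)

definition near_meet :: "'a \<Rightarrow> 'a \<Rightarrow> 'a"
  where "near_meet x y = (x\<^sup>\<alpha> * y)\<^sup>\<alpha> * y"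

lemma near_meet_commute: "near_meet x y = near_meet y x"
  using lukasiewicz[of "x\<^sup>\<alpha>" "y\<^sup>\<alpha>"] by (simp add: near_meet_def alpha_involutive)

lemma near_meet_le2: "near_meet x y \<sqsubseteq> y"
  by (simp add: near_meet_def mult_join_le_right)

lemma near_meet_le1: "near_meet x y \<sqsubseteq> x"
  by (metis near_meet_commute near_meet_le2)

text \<open>After swapping the arguments, the inner product \<open>y\<^sup>\<alpha> * z\<close> is
  \<open>0\<close>, because \<open>y\<^sup>\<alpha> \<sqsubseteq> z\<^sup>\<alpha>\<close>; what
  remains is \<open>1 * z\<close>.\<close>

lemma near_meet_absorb: "z \<sqsubseteq> y \<Longrightarrow> near_meet z y = z"
  by (simp add: near_meet_commute[of z] near_meet_def[of y] mult_eq_zeroI alpha_antitone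
      alpha_zero mult_one_left)

lemma near_meet_mono1: "z \<sqsubseteq> x \<Longrightarrow> near_meet z y \<sqsubseteq> near_meet x y"
  by (simp add: near_meet_def alpha_antitone mult_right_mono_join)

lemma near_meet_greatest: "z \<sqsubseteq> x \<Longrightarrow> z \<sqsubseteq> y \<Longrightarrow> z \<sqsubseteq> near_meet x y"
  by (metis near_meet_absorb near_meet_mono1)

lemma near_meet_zero_right: "near_meet x 0 = 0"
  by (simp add: near_meet_def)

lemma add_eq_alpha_near_meet: "x + y = (near_meet (x\<^sup>\<alpha>) (y\<^sup>\<alpha>))\<^sup>\<alpha>"
proof (rule join_le_antisym)
  show "x + y \<sqsubseteq> (near_meet (x\<^sup>\<alpha>) (y\<^sup>\<alpha>))\<^sup>\<alpha>"
    by (rule add_join_le; rule alpha_join_le_swap; rule near_meet_le1 near_meet_le2)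
  have "(x + y)\<^sup>\<alpha> \<sqsubseteq> near_meet (x\<^sup>\<alpha>) (y\<^sup>\<alpha>)"
    by (intro near_meet_greatest alpha_antitone join_le_add1 join_le_add2)
  then show "(near_meet (x\<^sup>\<alpha>) (y\<^sup>\<alpha>))\<^sup>\<alpha> \<sqsubseteq> x + y"
    by (metis alpha_antitone alpha_involutive)
qed

text \<open>Eliminates \<open>+\<close>, so compatibility of \<open>ideal_rel\<close> with joins
  follows from that with \<open>*\<close> and \<alpha>.\<close>

lemma add_eq_mult_alpha: "x + y = ((x * y\<^sup>\<alpha>)\<^sup>\<alpha> * y\<^sup>\<alpha>)\<^sup>\<alpha>"
  by (simp add: add_eq_alpha_near_meet near_meet_def alpha_involutive)

end

subsection \<open>The congruence of an ideal\<close>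

definition ideal_rel :: "'a::lukasiewicz_near_semiring set \<Rightarrow> 'a \<Rightarrow> 'a \<Rightarrow> bool"
  where "ideal_rel J x y \<longleftrightarrow> x\<^sup>\<alpha> * y \<in> J \<and> y\<^sup>\<alpha> * x \<in> J"

lemma ideal_rel_sym: "ideal_rel J x y \<Longrightarrow> ideal_rel J y x"
  by (simp add: ideal_rel_def)

lemma is_ideal_zero: "is_ideal J \<Longrightarrow> 0 \<in> J"
  by (simp add: is_ideal_def)

lemma is_ideal_cancel: "is_ideal J \<Longrightarrow> x * y\<^sup>\<alpha> \<in> J \<Longrightarrow> y \<in> J \<Longrightarrow> x \<in> J"
  unfolding is_ideal_def by blast

lemma ideal_rel_refl: "is_ideal J \<Longrightarrow> ideal_rel J x x"
  by (simp add: ideal_rel_def alpha_mult_self is_ideal_zero)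

lemma ideal_rel_zero_iff: "is_ideal J \<Longrightarrow> ideal_rel J x 0 \<longleftrightarrow> x \<in> J"
  by (simp add: ideal_rel_def alpha_zero mult_one_left is_ideal_zero)

lemma ideal_rel_mult_left: "is_ideal J \<Longrightarrow> ideal_rel J x y \<Longrightarrow> ideal_rel J (c * x) (c * y)"
  unfolding is_ideal_def ideal_rel_def by blast

lemma ideal_rel_mult_right: "is_ideal J \<Longrightarrow> ideal_rel J x y \<Longrightarrow> ideal_rel J (x * c) (y * c)"
  unfolding is_ideal_def ideal_rel_def by blast

text \<open>Bridges the two sides on which \<alpha> occurs: \<open>ideal_rel\<close> has it on the
  left factor, condition (I1) on the right. Multiplying by \<open>y\<^sup>\<alpha>\<close> relates
  \<open>x * y\<^sup>\<alpha>\<close> to \<open>y * y\<^sup>\<alpha> = 0\<close>.\<close>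

lemma ideal_rel_mult_alpha_mem:
  assumes "is_ideal J" "ideal_rel J x y"
  shows "x * y\<^sup>\<alpha> \<in> J"
  using ideal_rel_mult_right[OF assms, of "y\<^sup>\<alpha>"] ideal_rel_zero_iff[OF assms(1)]
  by (simp add: mult_alpha_self)

lemma ideal_rel_alpha: "is_ideal J \<Longrightarrow> ideal_rel J x y \<Longrightarrow> ideal_rel J (x\<^sup>\<alpha>) (y\<^sup>\<alpha>)"
  using ideal_rel_mult_alpha_mem[of J x y] ideal_rel_mult_alpha_mem[of J y x]
  by (simp add: ideal_rel_def alpha_involutive)

lemma ideal_rel_mem:
  assumes "is_ideal J" "ideal_rel J x y" "y \<in> J"
  shows "x \<in> J"
  using is_ideal_cancel[OF assms(1) ideal_rel_mult_alpha_mem[OF assms(1,2)] assms(3)] .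

lemma ideal_rel_trans:
  assumes J: "is_ideal J" and xy: "ideal_rel J x y" and yz: "ideal_rel J y z"
  shows "ideal_rel J x z"
proof -
  \<comment> \<open>\<open>u\<^sup>\<alpha> * w\<close> is related to
    \<open>v\<^sup>\<alpha> * w\<close>, which lies in \<open>J\<close>, and \<open>J\<close> is
    closed under the relation.\<close>
  have half: "u\<^sup>\<alpha> * w \<in> J" if "ideal_rel J u v" "ideal_rel J v w" for u v w
    using ideal_rel_mem[OF J ideal_rel_mult_right[OF J ideal_rel_alpha[OF J that(1)]]] that(2)
    by (simp add: ideal_rel_def)
  show ?thesis
    using half[OF xy yz] half[OF ideal_rel_sym[OF yz] ideal_rel_sym[OF xy]]
    by (simp add: ideal_rel_def)
qed

lemma ideal_rel_mult:
  "is_ideal J \<Longrightarrow> ideal_rel J x y \<Longrightarrow> ideal_rel J u v \<Longrightarrow> ideal_rel J (x * u) (y * v)"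
  using ideal_rel_trans[OF _ ideal_rel_mult_right ideal_rel_mult_left] by blast

lemma ideal_rel_add:
  "is_ideal J \<Longrightarrow> ideal_rel J x y \<Longrightarrow> ideal_rel J u v \<Longrightarrow> ideal_rel J (x + u) (y + v)"
  by (simp add: add_eq_mult_alpha ideal_rel_mult ideal_rel_alpha)

lemma ideal_rel_eval_term:
  assumes "is_ideal J" "\<And>i. ideal_rel J (\<sigma> i) (\<tau> i)"
  shows "ideal_rel J (eval_term \<sigma> t) (eval_term \<tau> t)"
  by (induction t)
    (simp_all add: assms ideal_rel_refl ideal_rel_add ideal_rel_mult ideal_rel_alpha)

lemma ideal_rel_Pol1:
  assumes J: "is_ideal J" and "ideal_rel J x y" "p \<in> Pol1"
  shows "ideal_rel J (p x) (p y)"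
proof -
  obtain t es where p: "p = (\<lambda>x. eval_term (\<lambda>i. (x # es) ! i) t)"
    using assms(3) by (auto simp: Pol1_def)
  \<comment> \<open>The two lists differ only at position 0; any later index, even one out of range,
    reads the same \<open>es ! j\<close> on both sides.\<close>
  have "ideal_rel J ((x # es) ! i) ((y # es) ! i)" for i
    using assms by (cases i) (simp_all add: ideal_rel_refl)
  then show ?thesis
    by (simp add: p ideal_rel_eval_term[OF J])
qed

subsection \<open>Unary polynomials\<close>

lemma eval_term_cong:
  "(\<And>i. i \<in> vars t \<Longrightarrow> \<sigma> i = \<tau> i) \<Longrightarrow> eval_term \<sigma> t = eval_term \<tau> t"
  by (induction t) simp_all

primrec rename_vars :: "(nat \<Rightarrow> nat) \<Rightarrow> nsr_term \<Rightarrow> nsr_term" where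
  "rename_vars f (Var i) = Var (f i)"
| "rename_vars f Zero = Zero"
| "rename_vars f One = One"
| "rename_vars f (Add s t) = Add (rename_vars f s) (rename_vars f t)"
| "rename_vars f (Mult s t) = Mult (rename_vars f s) (rename_vars f t)"
| "rename_vars f (Alpha t) = Alpha (rename_vars f t)"

lemma vars_rename_vars: "vars (rename_vars f t) = f ` vars t"
  by (induction t) (simp_all add: image_Un)

lemma eval_rename_vars: "eval_term \<sigma> (rename_vars f t) = eval_term (\<lambda>i. \<sigma> (f i)) t"
  by (induction t) simp_all

lemma Pol1_common_parameters:
  assumes "p \<in> Pol1" "q \<in> Pol1"
  obtains s t es where "vars s \<subseteq> {..length es}" "vars t \<subseteq> {..length es}"
    "p = (\<lambda>x. eval_term (\<lambda>i. (x # es) ! i) s)" "q = (\<lambda>x. eval_term (\<lambda>i. (x # es) ! i) t)"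
proof -
  obtain s es where s: "vars s \<subseteq> {..length es}" "p = (\<lambda>x. eval_term (\<lambda>i. (x # es) ! i) s)"
    using assms(1) by (auto simp: Pol1_def)
  obtain t fs where t: "vars t \<subseteq> {..length fs}" "q = (\<lambda>x. eval_term (\<lambda>i. (x # fs) ! i) t)"
    using assms(2) by (auto simp: Pol1_def)
  \<comment> \<open>Both polynomials will use the parameters \<open>es @ fs\<close>: variable 0
    stays the argument, and the parameters of \<open>t\<close> move past those of
    \<open>s\<close>.\<close>
  define f where "f i = (if i = 0 then 0 else i + length es)" for i
  show thesis
  proof
    show "vars s \<subseteq> {..length (es @ fs)}"
      using s(1) by auto
    show "vars (rename_vars f t) \<subseteq> {..length (es @ fs)}"
      using t(1) by (auto simp: vars_rename_vars f_def)
    show "p = (\<lambda>x. eval_term (\<lambda>i. (x # es @ fs) ! i) s)"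
      unfolding s(2)
    \<comment> \<open>Beyond \<open>es\<close> the longer list reads \<open>fs\<close>, so agreement
      is claimed only at the variables of \<open>s\<close>.\<close>
    proof (intro ext eval_term_cong)
      fix x i assume "i \<in> vars s"
      then have "i < length (x # es)" using s(1) by auto
      then show "(x # es) ! i = (x # es @ fs) ! i"
        by (metis append_Cons nth_append)
    qed
    show "q = (\<lambda>x. eval_term (\<lambda>i. (x # es @ fs) ! i) (rename_vars f t))"
      unfolding t(2) eval_rename_vars
    proof (intro ext eval_term_cong)
      fix x i
      show "(x # fs) ! i = (x # es @ fs) ! f i"
        by (cases i) (simp_all add: f_def nth_append)
    qed
  qed
qed

lemma Pol1_id: "(\<lambda>x. x) \<in> Pol1"
proof -
  have "(\<lambda>x. x) = (\<lambda>x::'a. eval_term (\<lambda>i. [x] ! i) (Var 0))" by simp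
  then show ?thesis unfolding Pol1_def
    by (intro CollectI exI[of _ "Var 0"] exI[of _ "[]"]) simp
qed

lemma Pol1_const: "(\<lambda>x. c) \<in> Pol1"
  unfolding Pol1_def by (intro CollectI exI[of _ "Var 1"] exI[of _ "[c]"]) simp

lemma Pol1_alpha: "p \<in> Pol1 \<Longrightarrow> (\<lambda>x. (p x)\<^sup>\<alpha>) \<in> Pol1"
proof -
  assume "p \<in> Pol1"
  then obtain t es where "vars t \<subseteq> {..length es}" "p = (\<lambda>x. eval_term (\<lambda>i. (x # es) ! i) t)"
    by (auto simp: Pol1_def)
  then show ?thesis
    unfolding Pol1_def by (intro CollectI exI[of _ "Alpha t"] exI[of _ es]) simp
qed

lemma Pol1_add: "p \<in> Pol1 \<Longrightarrow> q \<in> Pol1 \<Longrightarrow> (\<lambda>x. p x + q x) \<in> Pol1"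
proof (erule (1) Pol1_common_parameters)
  fix s t es
  assume "vars s \<subseteq> {..length es}" "vars t \<subseteq> {..length es}"
    "p = (\<lambda>x. eval_term (\<lambda>i. (x # es) ! i) s)" "q = (\<lambda>x. eval_term (\<lambda>i. (x # es) ! i) t)"
  then show ?thesis
    unfolding Pol1_def by (intro CollectI exI[of _ "Add s t"] exI[of _ es]) simp
qed

lemma Pol1_mult: "p \<in> Pol1 \<Longrightarrow> q \<in> Pol1 \<Longrightarrow> (\<lambda>x. p x * q x) \<in> Pol1"
proof (erule (1) Pol1_common_parameters)
  fix s t es
  assume "vars s \<subseteq> {..length es}" "vars t \<subseteq> {..length es}"
    "p = (\<lambda>x. eval_term (\<lambda>i. (x # es) ! i) s)" "q = (\<lambda>x. eval_term (\<lambda>i. (x # es) ! i) t)"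
  then show ?thesis
    unfolding Pol1_def by (intro CollectI exI[of _ "Mult s t"] exI[of _ es]) simp
qed

lemma Pol1_near_meet: "p \<in> Pol1 \<Longrightarrow> q \<in> Pol1 \<Longrightarrow> (\<lambda>x. near_meet (p x) (q x)) \<in> Pol1"
  unfolding near_meet_def by (intro Pol1_mult Pol1_alpha)

subsection \<open>The ideal generated by an element\<close>

lemma is_ideal_Pol1_values: "is_ideal {p a | p. p \<in> Pol1 \<and> p 0 = 0}" (is "is_ideal ?S")
proof -
  have memI: "y \<in> ?S" if "p \<in> Pol1" "p 0 = 0" "p a = y" for p y
    using that by blast
  have "x \<in> ?S" if S: "x * y\<^sup>\<alpha> \<in> ?S" "y \<in> ?S" for x y
  proof -
    obtain p q where p: "p \<in> Pol1" "p 0 = 0" "p a = x * y\<^sup>\<alpha>"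
      and q: "q \<in> Pol1" "q 0 = 0" "q a = y"
      using S by force
    \<comment> \<open>At \<open>a\<close> the second argument of the meet is \<open>x + y\<close> by
      \<open>add_eq_mult_alpha\<close>, which lies above \<open>x\<close>; at \<open>0\<close> it is
      \<open>(1 * 1)\<^sup>\<alpha> = 0\<close>.\<close>
    define r where "r z = near_meet x (((p z)\<^sup>\<alpha> * (q z)\<^sup>\<alpha>)\<^sup>\<alpha>)" for z
    show ?thesis
    proof (rule memI)
      show "r \<in> Pol1"
        unfolding r_def by (intro Pol1_near_meet Pol1_mult Pol1_alpha Pol1_const p q)
      show "r 0 = 0"
        by (simp add: r_def p q alpha_zero alpha_one mult_one_left near_meet_zero_right)
      show "r a = x"
        by (simp add: r_def p q near_meet_absorb join_le_add1 flip: add_eq_mult_alpha)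
    qed
  qed
  moreover have "(x * c)\<^sup>\<alpha> * (y * c) \<in> ?S \<and> (c * x)\<^sup>\<alpha> * (c * y) \<in> ?S"
    if S: "x\<^sup>\<alpha> * y \<in> ?S" "y\<^sup>\<alpha> * x \<in> ?S" for x y c
  proof -
    obtain p q where p: "p \<in> Pol1" "p 0 = 0" "p a = x\<^sup>\<alpha> * y"
      and q: "q \<in> Pol1" "q 0 = 0" "q a = y\<^sup>\<alpha> * x"
      using S by force
    \<comment> \<open>At \<open>a\<close> the first summand is the meet of \<open>x\<close> and
      \<open>y\<close>, absorbed by \<open>x\<close>; at \<open>0\<close> it is
      \<open>y\<close>.\<close>
    define f where "f z = (p z)\<^sup>\<alpha> * y + x" for z
    define g where "g z = (q z)\<^sup>\<alpha> * x + y" for z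
    have Pol: "f \<in> Pol1" "g \<in> Pol1"
      unfolding f_def g_def by (intro Pol1_add Pol1_mult Pol1_alpha Pol1_const p q)+
    have zero: "f 0 = g 0"
      by (simp add: f_def g_def p q alpha_zero mult_one_left add.commute)
    have "f a = near_meet x y + x" "g a = near_meet y x + y"
      by (simp_all add: f_def g_def p q near_meet_def)
    then have vals: "f a = x" "g a = y"
      using near_meet_le1[of x y] near_meet_le1[of y x] by (simp_all add: join_le_def)
    show ?thesis
    proof
      \<comment> \<open>Since \<open>f 0 = g 0\<close>, both witnesses take the form
        \<open>w\<^sup>\<alpha> * w = 0\<close> at \<open>0\<close>.\<close>
      show "(x * c)\<^sup>\<alpha> * (y * c) \<in> ?S"
        by (rule memI[of "\<lambda>z. (f z * c)\<^sup>\<alpha> * (g z * c)"])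
          (intro Pol1_mult Pol1_alpha Pol1_const Pol | simp add: zero vals alpha_mult_self)+
      show "(c * x)\<^sup>\<alpha> * (c * y) \<in> ?S"
        by (rule memI[of "\<lambda>z. (c * f z)\<^sup>\<alpha> * (c * g z)"])
          (intro Pol1_mult Pol1_alpha Pol1_const Pol | simp add: zero vals alpha_mult_self)+
    qed
  qed
  moreover have "0 \<in> ?S"
    by (rule memI[OF Pol1_const]) simp_all
  ultimately show ?thesis
    unfolding is_ideal_def by blast
qed

theorem theorem5:
  fixes a :: "'a::lukasiewicz_near_semiring"
  shows "is_least_ideal_containing a {p a | p. p \<in> Pol1 \<and> p 0 = 0}"
proof -
  have "a \<in> {p a | p. p \<in> Pol1 \<and> p 0 = 0}"
    using Pol1_id by force
  \<comment> \<open>\<open>a\<close> is related to \<open>0\<close>, hence \<open>p a\<close> to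
    \<open>p 0 = 0\<close>, which says that \<open>p a\<close> lies in \<open>J\<close>.\<close>
  moreover have "p a \<in> J" if "is_ideal J" "a \<in> J" "p \<in> Pol1" "p 0 = 0" for p J
    using ideal_rel_Pol1[of J a 0 p] that by (simp add: ideal_rel_zero_iff)
  ultimately show ?thesis
    unfolding is_least_ideal_containing_def by (auto intro: is_ideal_Pol1_values)
qed

end
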